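(* Let $m>0$, let $\psi\in\Psi$ be of class $EL_m$, and let $\nu\in\Psi$. The following two conditions are equivalent: (i) for every centered martingale $(S_n,F_n)$ on any probability space with $\sup_n\|S_n\|G(\psi)<\infty$ one has $\lim_{n\to\infty}\|S_n-S\|G(\nu)=0$, where $S=\lim_{n\to\infty}S_n$ almost everywhere; (ii) $\lim_{p\to\infty}\psi(p)/\nu(p)=0$ (or, equivalently, $N_\nu\ll N_\psi$).
   Context: On a probability space $(\Omega,F,\mathbf P)$ with expectation $\mathbf E$ put $|\eta|_p=(\mathbf E|\eta|^p)^{1/p}$. A centered martingale $(S_n,F_n)$ is a martingale with respect to a filtration $\{\emptyset,\Omega\}=F_0\subset F_1\subset F_2\subset\dots\subset F$ with $\mathbf E S_n=0$ and $\mathbf E|S_n|<\infty$ for all $n$. $\Psi$ is the set of all functions $\psi(p)=\exp(W^*(p)/p)$, $p\ge2$, where $W^*(p)=\sup_{z\ge2}(pz-W(z))$ and $W:[2,\infty)\to\mathbb R$ is continuous, strictly increasing, convex, with left derivative $W'_-(u)\to\infty$ as $u\to\infty$. The corresponding $N$-function is $N_\psi(u)=\exp\{[p\log\psi(p)]^*(\log u)\}$, where $h^*(z)=\sup_{p\ge2}(pz-h(p))$; it equals $\exp(W(\log u))$ for large $u$. $G(\psi)$ is the space of measurable $\eta:\Omega\to\mathbb R$ with $\|\eta\|G(\psi)=\sup_{p\ge2}|\eta|_p/\psi(p)<\infty$. "$\psi$ is of class $EL_m$" means that $\psi(p)=\exp(W^*(p)/p)$ for a continuous, strictly increasing, convex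 function $W:[2,\infty)\to\mathbb R$ with left derivative $W'_-(u)\to\infty$ as $u\to\infty$, of the form $W(\log u)=u^mL(u)$, $u\ge e^2$ (so $N_\psi(u)=\exp(u^mL(u))$), with $L\in SV_m$, where $SV_m$ is the set of all continuous functions $L:[0,\infty)\to(0,\infty)$, slowly varying at infinity, such that $L(0)>0$, $u^mL(u)\uparrow\infty$ as $u\uparrow\infty$, and $\lim_{u\to\infty}L(u/L(u))/L(u)=1$. For $N$-functions $M,N$, $M\ll N$ means $\lim_{u\to\infty}M(\lambda u)/N(u)=0$ for every $\lambda>0$. The almost everywhere limit $S$ in (i) exists by Doob's theorem, since $\sup_n|S_n|_2<\infty$. *)

theory Defs
  imports "HOL-Probability.Probability"
begin

text \<open>
  The supremum is taken in \<^typ>\<open>real\<close>, so it is meaningful only when the set is bounded above.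
  This holds in every use below: it is applied to functions \<open>W\<close> satisfying \<open>admissible\<close>, and to
  \<open>h p = conj2 W p\<close>, and both grow superlinearly.
\<close>

definition conj2 :: "(real \<Rightarrow> real) \<Rightarrow> real \<Rightarrow> real" where
  "conj2 h z = (SUP p\<in>{2..}. p * z - h p)"

text \<open>
  Functions on \<open>[2,\<infinity>)\<close> are represented by total functions on the reals of which only the
  values on \<open>{2..}\<close> are constrained. The function \<open>W'\<close> below is the left derivative of \<open>W\<close>.
\<close>

definition admissible :: "(real \<Rightarrow> real) \<Rightarrow> bool" where
  "admissible W \<longleftrightarrow>
     continuous_on {2..} W \<and> strict_mono_on {2..} W \<and> convex_on {2..} W \<and>
     (\<exists>W'. (\<forall>u>2. (W has_real_derivative W' u) (at_left u)) \<and> filterlim W' at_top at_top)"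

definition generates :: "(real \<Rightarrow> real) \<Rightarrow> (real \<Rightarrow> real) \<Rightarrow> bool" where
  "generates W \<psi> \<longleftrightarrow> (\<forall>p\<ge>2. \<psi> p = exp (conj2 W p / p))"

definition Psi :: "(real \<Rightarrow> real) set" where
  "Psi = {\<psi>. \<exists>W. admissible W \<and> generates W \<psi>}"

definition slowly_varying :: "(real \<Rightarrow> real) \<Rightarrow> bool" where
  "slowly_varying L \<longleftrightarrow> (\<forall>c>0. ((\<lambda>u. L (c * u) / L u) \<longlongrightarrow> 1) at_top)"

definition SV :: "real \<Rightarrow> (real \<Rightarrow> real) set" where
  "SV m = {L. continuous_on {0..} L \<and> (\<forall>u\<ge>0. L u > 0) \<and> slowly_varying L \<and>
              mono_on {0..} (\<lambda>u. u powr m * L u) \<and>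
              filterlim (\<lambda>u. u powr m * L u) at_top at_top \<and>
              ((\<lambda>u. L (u / L u) / L u) \<longlongrightarrow> 1) at_top}"

definition EL :: "real \<Rightarrow> (real \<Rightarrow> real) set" where
  "EL m = {\<psi>. \<exists>W L. admissible W \<and> generates W \<psi> \<and> L \<in> SV m \<and>
                   (\<forall>u\<ge>exp 2. W (ln u) = u powr m * L u)}"

text \<open>Only the values at \<open>u > 0\<close> are meaningful.\<close>

definition N_fun :: "(real \<Rightarrow> real) \<Rightarrow> real \<Rightarrow> real" where
  "N_fun \<psi> u = exp (conj2 (\<lambda>p. p * ln (\<psi> p)) (ln u))"

definition weaker :: "(real \<Rightarrow> real) \<Rightarrow> (real \<Rightarrow> real) \<Rightarrow> bool" (infix "\<lless>" 50) where
  "M \<lless> N \<longleftrightarrow> (\<forall>c>0. ((\<lambda>u. M (c * u) / N u) \<longlongrightarrow> 0) at_top)"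

text \<open>
  The norms take values in \<^typ>\<open>ennreal\<close>, so that they are infinite exactly outside the
  corresponding space. The case distinction is the \<open>p\<close>-th root on \<^typ>\<open>ennreal\<close>.
\<close>

definition Lp_norm :: "'a measure \<Rightarrow> real \<Rightarrow> ('a \<Rightarrow> real) \<Rightarrow> ennreal" where
  "Lp_norm M p \<eta> =
     (let I = (\<integral>\<^sup>+ x. ennreal (\<bar>\<eta> x\<bar> powr p) \<partial>M)
      in if I = \<infinity> then \<infinity> else ennreal (enn2real I powr (1 / p)))"

definition G_norm :: "'a measure \<Rightarrow> (real \<Rightarrow> real) \<Rightarrow> ('a \<Rightarrow> real) \<Rightarrow> ennreal" where
  "G_norm M \<psi> \<eta> = (SUP p\<in>{2..}. Lp_norm M p \<eta> / ennreal (\<psi> p))"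

definition centered_martingale ::
    "'a measure \<Rightarrow> (nat \<Rightarrow> 'a measure) \<Rightarrow> (nat \<Rightarrow> 'a \<Rightarrow> real) \<Rightarrow> bool" where
  "centered_martingale M F S \<longleftrightarrow>
     filtration (space M) F \<and> (\<forall>n. subalgebra M (F n)) \<and> sets (F 0) = {{}, space M} \<and>
     (\<forall>n. S n \<in> borel_measurable (F n)) \<and>
     (\<forall>n. integrable M (S n)) \<and> (\<forall>n. (\<integral>x. S n x \<partial>M) = 0) \<and>
     (\<forall>k n. k \<le> n \<longrightarrow> (AE x in M. real_cond_exp M (F k) (S n) x = S k x))"

text \<open>
  The almost everywhere limit \<open>T\<close> exists by Doob's theorem and is unique up to null sets, so it
  does not matter that \<open>T\<close> is quantified universally.
\<close>

definition martingales_converge ::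
    "'a measure \<Rightarrow> (real \<Rightarrow> real) \<Rightarrow> (real \<Rightarrow> real) \<Rightarrow> bool" where
  "martingales_converge M \<psi> \<nu> \<longleftrightarrow>
     (\<forall>F S T. centered_martingale M F S \<longrightarrow> (SUP n. G_norm M \<psi> (S n)) < \<infinity> \<longrightarrow>
        T \<in> borel_measurable M \<longrightarrow> (AE x in M. (\<lambda>n. S n x) \<longlonglongrightarrow> T x) \<longrightarrow>
        (\<lambda>n. G_norm M \<nu> (\<lambda>x. S n x - T x)) \<longlonglongrightarrow> 0)"

text \<open>
  ``On any probability space'' cannot be quantified over types inside a formula. A theorem about
  both \<open>all_martingales_converge TYPE(real)\<close> and \<open>all_martingales_converge TYPE('a)\<close>, with \<open>'a\<close>
  free, captures it: see the first two conjuncts of the main statement.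
\<close>

definition all_martingales_converge ::
    "'a itself \<Rightarrow> (real \<Rightarrow> real) \<Rightarrow> (real \<Rightarrow> real) \<Rightarrow> bool" where
  "all_martingales_converge _ \<psi> \<nu> \<longleftrightarrow>
     (\<forall>M :: 'a measure. prob_space M \<longrightarrow> martingales_converge M \<psi> \<nu>)"

end

theory Submission
  imports Defs "HOL-Real_Asymp.Real_Asymp"
begin

text \<open>
  If \<open>\<psi> / \<nu>\<close> tends to \<open>0\<close>, the bound on the \<open>\<psi>\<close>-norms makes the contribution of large \<open>p\<close> to the
  \<open>\<nu>\<close>-norm of \<open>S n - T\<close> uniformly small, while for bounded \<open>p\<close> the moments tend to \<open>0\<close> because moments
  of higher order are bounded.

  Conversely, let \<open>\<eta>\<close> be symmetric with \<open>\<bar>\<eta>\<bar>\<close> taking the value \<open>exp v\<close>, for integers \<open>v \<ge> 2\<close>, with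
  probability proportional to \<open>exp (- W v)\<close>. Its \<open>p\<close>-norm is of order \<open>\<psi> p\<close>, and since the maximiser
  of \<open>p * v - W v\<close> escapes to infinity with \<open>p\<close>, so is the \<open>p\<close>-norm of \<open>\<eta>\<close> minus any truncation of
  \<open>\<eta>\<close>, for large \<open>p\<close>. By symmetry the truncations form a martingale, and its convergence in the
  \<open>\<nu>\<close>-norm forces \<open>\<psi> / \<nu>\<close> to tend to \<open>0\<close>. The class \<open>EL\<close> enters only through the growth of \<open>W\<close>,
  which bounds the number of relevant terms in the moments of \<open>\<eta>\<close>.

  The comparison of \<open>N\<close>-functions is the same statement for the conjugates: adding a linear function
  of \<open>p\<close> to \<open>conj2 W\<close> translates its conjugate.
\<close>

section \<open>Conjugate functions\<close>

text \<open>Past a point \<open>u\<close> where the left derivative is at least \<open>p\<close>,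
  convexity keeps \<open>W\<close> above the line of slope \<open>p\<close> through
  \<open>(u, W u)\<close>. Up to \<open>u\<close>, monotonicity of \<open>W\<close>
  suffices.\<close>

lemma admissible_bdd_above:
  assumes "admissible W"
  shows "bdd_above ((\<lambda>v. v * p - W v) ` {2..})"
proof -
  obtain W' where conv: "convex_on {2..} W" and smono: "strict_mono_on {2..} W"
    and der: "\<And>u. u > 2 \<Longrightarrow> (W has_real_derivative W' u) (at_left u)"
    and lim: "filterlim W' at_top at_top"
    using assms unfolding admissible_def by blast
  have "eventually (\<lambda>u. W' u \<ge> p \<and> u > 2) at_top"
    using lim eventually_gt_at_top[of 2] by (auto simp: filterlim_at_top eventually_conj_iff)
  then obtain u where u: "W' u \<ge> p" "u > 2"
    unfolding eventually_at_top_linorder by blast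
  have mono: "W 2 \<le> W v" if "v \<ge> 2" for v
    using smono that by (cases "v = 2") (auto simp: strict_mono_on_def intro: less_imp_le)
  have supp: "W v \<ge> W u + p * (v - u)" if v: "v > u" for v
  proof -
    have "((\<lambda>y. (W y - W u) / (y - u)) \<longlongrightarrow> W' u) (at_left u)"
      using der[OF u(2)] by (simp add: has_field_derivative_iff)
    moreover have "eventually (\<lambda>y. (W y - W u) / (y - u) \<le> (W v - W u) / (v - u)) (at_left u)"
    proof -
      have "eventually (\<lambda>y. y \<in> {2<..<u}) (at_left u)"
        using eventually_at_left_real[OF u(2)] .
      then show ?thesis
      proof eventually_elim
        case (elim y)
        have "(W y - W u) / (y - u) \<le> (W y - W v) / (y - v)"
          using convex_on_slope_le(1)[OF conv, of y v u] elim v u by auto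
        also have "\<dots> \<le> (W u - W v) / (u - v)"
          using convex_on_slope_le(2)[OF conv, of y v u] elim v u by auto
        also have "\<dots> = (W v - W u) / (v - u)"
          by (metis minus_diff_eq minus_divide_divide)
        finally show ?case .
      qed
    qed
    ultimately have "W' u \<le> (W v - W u) / (v - u)"
      by (rule tendsto_upperbound) simp
    with u have "p \<le> (W v - W u) / (v - u)" by simp
    then show ?thesis using v by (simp add: field_simps)
  qed
  have "v * p - W v \<le> u * \<bar>p\<bar> + \<bar>W 2\<bar> + \<bar>W u\<bar>" if "v \<ge> 2" for v
  proof (cases "v > u")
    case True
    have "u * p \<le> u * \<bar>p\<bar>" using u by (simp add: mult_left_mono)
    then show ?thesis using supp[OF True] by (simp add: algebra_simps)
  next
    case False
    have "v * p \<le> v * \<bar>p\<bar>" using that by (simp add: mult_left_mono)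
    also have "\<dots> \<le> u * \<bar>p\<bar>" using False by (simp add: mult_right_mono)
    finally show ?thesis using mono[OF that] by linarith
  qed
  then show ?thesis by (auto intro!: bdd_aboveI2)
qed

lemma conj2_upper:
  assumes "admissible W" "v \<ge> 2"
  shows "v * p - W v \<le> conj2 W p"
  unfolding conj2_def using admissible_bdd_above[OF assms(1)] assms(2)
  by (intro cSUP_upper) auto

lemma conj2_least: "(\<And>p. p \<ge> 2 \<Longrightarrow> p * z - h p \<le> C) \<Longrightarrow> conj2 h z \<le> C"
  unfolding conj2_def by (intro cSUP_least) auto

lemma conj2_biconjugate_upper:
  assumes "admissible W" "p \<ge> 2"
  shows "p * z - conj2 W p \<le> conj2 (conj2 W) z"
proof -
  \<comment> \<open>For \<open>z < 2\<close> the point \<open>z\<close> lies outside the domain of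
    \<open>W\<close>. Since \<open>q > 0\<close>, replacing it by \<open>max z 2\<close> only
    increases the linear term.\<close>
  have "q * z - conj2 W q \<le> W (max z 2)" if "q \<ge> 2" for q
  proof -
    have "q * z \<le> max z 2 * q" using that by (simp add: mult.commute)
    then show ?thesis using conj2_upper[OF assms(1), of "max z 2" q] by simp
  qed
  then have "bdd_above ((\<lambda>q. q * z - conj2 W q) ` {2..})"
    by (auto intro!: bdd_aboveI2)
  then show ?thesis unfolding conj2_def[of "conj2 W"] using assms(2)
    by (intro cSUP_upper) auto
qed

lemma conj2_biconjugate_le:
  assumes "admissible W" "z \<ge> 2"
  shows "conj2 (conj2 W) z \<le> W z"
  using conj2_upper[OF assms] by (intro conj2_least) (simp add: algebra_simps)

text \<open>A near-maximiser below \<open>Y = max Z 2\<close> would lose to \<open>Y + 1\<close>: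
  the linear term gains at least \<open>p\<close>, while \<open>W\<close> costs at most
  \<open>W (Y + 1) - W 2\<close>. With the slack 1 this gives the threshold on
  \<open>p\<close>.\<close>

lemma eventually_conj2_approx:
  assumes "admissible W"
  shows "eventually (\<lambda>p. \<exists>v\<ge>Z. v \<ge> 2 \<and> conj2 W p - 1 \<le> v * p - W v) at_top"
  using eventually_ge_at_top[of "max 0 (W (max Z 2 + 1) - W 2 + 1)"]
proof eventually_elim
  case (elim p)
  define Y where "Y = max Z 2"
  have "(SUP v\<in>{2..}. v * p - W v) > conj2 W p - 1" unfolding conj2_def by simp
  then obtain v where v: "v \<ge> 2" "conj2 W p - 1 < v * p - W v"
    using less_cSUP_iff[OF _ admissible_bdd_above[OF assms]] by auto
  have "v \<ge> Y"
  proof (rule ccontr)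
    assume "\<not> v \<ge> Y"
    then have "v * p \<le> Y * p" using elim by (simp add: mult_right_mono)
    moreover have "W 2 \<le> W v"
      using assms v(1) unfolding admissible_def
      by (cases "v = 2") (auto simp: strict_mono_on_def intro: less_imp_le)
    moreover have "(Y + 1) * p - W (Y + 1) \<le> conj2 W p"
      by (rule conj2_upper[OF assms]) (simp add: Y_def)
    ultimately show False using v elim by (simp add: algebra_simps flip: Y_def)
  qed
  then show ?case using v by (intro exI[of _ v]) (auto simp: Y_def)
qed

section \<open>The ratio condition and the comparison of N-functions\<close>

lemma exp_tendsto_0_iff:
  fixes f :: "'a \<Rightarrow> real"
  shows "((\<lambda>x. exp (f x)) \<longlongrightarrow> 0) F \<longleftrightarrow> (\<forall>K. eventually (\<lambda>x. f x \<le> - K) F)"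
proof
  assume lim: "((\<lambda>x. exp (f x)) \<longlongrightarrow> 0) F"
  show "\<forall>K. eventually (\<lambda>x. f x \<le> - K) F"
  proof
    fix K :: real
    have "eventually (\<lambda>x. exp (f x) < exp (- K)) F"
      using order_tendstoD(2)[OF lim, of "exp (- K)"] by simp
    then show "eventually (\<lambda>x. f x \<le> - K) F" by eventually_elim simp
  qed
next
  assume "\<forall>K. eventually (\<lambda>x. f x \<le> - K) F"
  then have "filterlim f at_bot F"
    unfolding filterlim_at_bot by (metis minus_minus)
  then show "((\<lambda>x. exp (f x)) \<longlongrightarrow> 0) F"
    by (rule filterlim_compose[OF exp_at_bot])
qed

text \<open>For \<open>p \<ge> P\<close> the gap \<open>(\<bar>a\<bar> + 1) * p\<close> absorbs the
  shift by \<open>a\<close> and leaves \<open>p \<ge> K\<close>. For large \<open>z\<close>, smaller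
  slopes lose against the single competitor \<open>P + 1\<close>, whose term grows faster in
  \<open>z\<close>.\<close>

lemma conjugate_gap_transfer:
  assumes W: "admissible W" and V: "admissible V"
    and gap: "\<And>K. eventually (\<lambda>p. (conj2 W p - conj2 V p) / p \<le> - K) at_top"
  shows "eventually (\<lambda>z. conj2 (conj2 V) (a + z) - conj2 (conj2 W) z \<le> - K) at_top"
proof -
  obtain P0 where P0: "\<And>p. p \<ge> P0 \<Longrightarrow> (conj2 W p - conj2 V p) / p \<le> - (\<bar>a\<bar> + 1)"
    using gap[of "\<bar>a\<bar> + 1"] unfolding eventually_at_top_linorder by blast
  define P where "P = max (max P0 2) K"
  \<comment> \<open>Collects the constants that arise when a slope \<open>p < P\<close> is compared
    with \<open>P + 1\<close>.\<close>
  define c where "c = P * \<bar>a\<bar> + \<bar>V 2\<bar> + conj2 W (P + 1) + K"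
  show ?thesis
    using eventually_ge_at_top[of "max 0 c"]
  proof eventually_elim
    case (elim z)
    have "p * (a + z) - conj2 V p \<le> conj2 (conj2 W) z - K" if p: "p \<ge> 2" for p
    proof (cases "p \<ge> P")
      case True
      then have "(conj2 W p - conj2 V p) / p \<le> - (\<bar>a\<bar> + 1)"
        using P0 unfolding P_def by auto
      then have "conj2 W p - conj2 V p \<le> - (\<bar>a\<bar> + 1) * p"
        using p by (simp add: pos_divide_le_eq)
      moreover have "p * a \<le> p * \<bar>a\<bar>" using p by (simp add: mult_left_mono)
      moreover have "p * z - conj2 W p \<le> conj2 (conj2 W) z"
        by (rule conj2_biconjugate_upper[OF W p])
      moreover have "p \<ge> K" using True unfolding P_def by simp
      ultimately show ?thesis by (simp add: algebra_simps)
    next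
      case False
      have "P \<ge> 2" unfolding P_def by simp
      have "p * a \<le> p * \<bar>a\<bar>" using p by (simp add: mult_left_mono)
      also have "\<dots> \<le> P * \<bar>a\<bar>" using False by (simp add: mult_right_mono)
      finally have 1: "p * a \<le> P * \<bar>a\<bar>" .
      have 2: "p * z \<le> P * z" using False elim by (simp add: mult_right_mono)
      have 3: "2 * p - V 2 \<le> conj2 V p" by (rule conj2_upper[OF V]) simp
      have 4: "(P + 1) * z - conj2 W (P + 1) \<le> conj2 (conj2 W) z"
        by (rule conj2_biconjugate_upper[OF W]) (use \<open>P \<ge> 2\<close> in simp)
      have "z \<ge> c" using elim by simp
      with 1 2 3 4 p show ?thesis unfolding c_def by (simp add: algebra_simps)
    qed
    then have "conj2 (conj2 V) (a + z) \<le> conj2 (conj2 W) z - K"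
      by (rule conj2_least)
    then show ?case by simp
  qed
qed

text \<open>At a near-maximiser \<open>v\<close> of \<open>p * v - W v\<close>, evaluating the
  biconjugate of \<open>V\<close> at \<open>a + v\<close> yields the gap \<open>p * a\<close> up to
  an error 1.\<close>

lemma biconjugate_gap_transfer:
  assumes W: "admissible W" and V: "admissible V"
    and gap: "\<And>a. eventually (\<lambda>z. conj2 (conj2 V) (a + z) - conj2 (conj2 W) z \<le> 0) at_top"
  shows "eventually (\<lambda>p. (conj2 W p - conj2 V p) / p \<le> - K) at_top"
proof -
  \<comment> \<open>The extra unit of shift contributes \<open>p\<close>, which pays for the slack 1
    of the near-maximiser.\<close>
  define a where "a = K + 1"
  obtain Z where Z: "\<And>z. z \<ge> Z \<Longrightarrow> conj2 (conj2 V) (a + z) \<le> conj2 (conj2 W) z"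
    using gap[of a] unfolding eventually_at_top_linorder by auto
  show ?thesis
    using eventually_conj2_approx[OF W, of Z] eventually_ge_at_top[of 2]
  proof eventually_elim
    case (elim p)
    then obtain v where v: "v \<ge> Z" "v \<ge> 2" "conj2 W p - 1 \<le> v * p - W v" by blast
    have "p * (a + v) - conj2 V p \<le> conj2 (conj2 V) (a + v)"
      by (rule conj2_biconjugate_upper[OF V]) (use elim in simp)
    also have "\<dots> \<le> conj2 (conj2 W) v" by (rule Z[OF v(1)])
    also have "\<dots> \<le> W v" by (rule conj2_biconjugate_le[OF W v(2)])
    finally have "conj2 W p - conj2 V p \<le> 1 - p * a"
      using v(3) by (simp add: algebra_simps)
    also have "\<dots> \<le> - K * p" using elim unfolding a_def by (simp add: algebra_simps)
    finally show ?case using elim by (simp add: pos_divide_le_eq)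
  qed
qed

lemma ratio_tendsto_0_iff:
  assumes "generates W \<psi>" "generates V \<nu>"
  shows "((\<lambda>p. \<psi> p / \<nu> p) \<longlongrightarrow> 0) at_top \<longleftrightarrow>
    (\<forall>K. eventually (\<lambda>p. (conj2 W p - conj2 V p) / p \<le> - K) at_top)"
proof -
  have "((\<lambda>p. \<psi> p / \<nu> p) \<longlongrightarrow> 0) at_top \<longleftrightarrow>
    ((\<lambda>p. exp ((conj2 W p - conj2 V p) / p)) \<longlongrightarrow> 0) at_top"
    using assms unfolding generates_def
    by (intro filterlim_cong refl eventually_mono[OF eventually_ge_at_top[of 2]])
      (simp add: diff_divide_distrib exp_diff)
  then show ?thesis by (simp only: exp_tendsto_0_iff)
qed

lemma N_fun_eq:
  assumes "generates W \<psi>"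
  shows "N_fun \<psi> u = exp (conj2 (conj2 W) (ln u))"
proof -
  have "conj2 (\<lambda>p. p * ln (\<psi> p)) (ln u) = conj2 (conj2 W) (ln u)"
    unfolding conj2_def[of "\<lambda>p. p * ln (\<psi> p)"] conj2_def[of "conj2 W"]
    using assms unfolding generates_def by (intro SUP_cong) auto
  then show ?thesis unfolding N_fun_def by simp
qed

text \<open>The substitution \<open>u = exp z\<close> turns dilation by \<open>c\<close> into
  translation by \<open>ln c\<close>.\<close>

lemma N_fun_weaker_iff:
  assumes "generates W \<psi>" "generates V \<nu>"
  shows "N_fun \<nu> \<lless> N_fun \<psi> \<longleftrightarrow>
    (\<forall>a K. eventually (\<lambda>z. conj2 (conj2 V) (a + z) - conj2 (conj2 W) z \<le> - K) at_top)"
proof -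
  have *: "((\<lambda>u. N_fun \<nu> (c * u) / N_fun \<psi> u) \<longlongrightarrow> 0) at_top \<longleftrightarrow>
    (\<forall>K. eventually (\<lambda>z. conj2 (conj2 V) (ln c + z) - conj2 (conj2 W) z \<le> - K) at_top)"
    if "c > 0" for c
  proof -
    let ?f = "\<lambda>z. conj2 (conj2 V) (ln c + z) - conj2 (conj2 W) z"
    have "((\<lambda>u. N_fun \<nu> (c * u) / N_fun \<psi> u) \<longlongrightarrow> 0) at_top \<longleftrightarrow>
      ((\<lambda>u. exp (?f (ln u))) \<longlongrightarrow> 0) at_top"
      using that
      by (intro filterlim_cong refl eventually_mono[OF eventually_gt_at_top[of 0]])
        (simp add: N_fun_eq[OF assms(1)] N_fun_eq[OF assms(2)] exp_diff ln_mult)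
    also have "\<dots> \<longleftrightarrow> ((\<lambda>z. exp (?f z)) \<longlongrightarrow> 0) at_top"
    proof
      assume "((\<lambda>u. exp (?f (ln u))) \<longlongrightarrow> 0) at_top"
      from filterlim_compose[OF this exp_at_top] show "((\<lambda>z. exp (?f z)) \<longlongrightarrow> 0) at_top" by simp
    next
      assume "((\<lambda>z. exp (?f z)) \<longlongrightarrow> 0) at_top"
      from filterlim_compose[OF this ln_at_top]
      show "((\<lambda>u. exp (?f (ln u))) \<longlongrightarrow> 0) at_top" .
    qed
    finally show ?thesis by (simp only: exp_tendsto_0_iff)
  qed
  show ?thesis
    unfolding weaker_def
  proof (intro iffI allI impI)
    fix a K
    assume "\<forall>c>0. ((\<lambda>u. N_fun \<nu> (c * u) / N_fun \<psi> u) \<longlongrightarrow> 0) at_top"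
    then show "eventually (\<lambda>z. conj2 (conj2 V) (a + z) - conj2 (conj2 W) z \<le> - K) at_top"
      using *[of "exp a"] by simp
  qed (use * in auto)
qed

lemma ratio_tendsto_0_iff_weaker:
  assumes "admissible W" "generates W \<psi>" "admissible V" "generates V \<nu>"
  shows "((\<lambda>p. \<psi> p / \<nu> p) \<longlongrightarrow> 0) at_top \<longleftrightarrow> N_fun \<nu> \<lless> N_fun \<psi>"
  unfolding ratio_tendsto_0_iff[OF assms(2,4)] N_fun_weaker_iff[OF assms(2,4)]
proof (intro iffI allI)
  fix a K
  assume "\<forall>K. eventually (\<lambda>p. (conj2 W p - conj2 V p) / p \<le> - K) at_top"
  then show "eventually (\<lambda>z. conj2 (conj2 V) (a + z) - conj2 (conj2 W) z \<le> - K) at_top"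
    by (intro conjugate_gap_transfer[OF assms(1,3)]) blast
next
  fix K
  assume *: "\<forall>a K. eventually (\<lambda>z. conj2 (conj2 V) (a + z) - conj2 (conj2 W) z \<le> - K) at_top"
  \<comment> \<open>Gap 0 is enough here because the shift \<open>a\<close> is arbitrary, and a
    larger shift gives a larger gap in \<open>p\<close>.\<close>
  have "eventually (\<lambda>z. conj2 (conj2 V) (a + z) - conj2 (conj2 W) z \<le> 0) at_top" for a
    using *[rule_format, of a 0] by simp
  then show "eventually (\<lambda>p. (conj2 W p - conj2 V p) / p \<le> - K) at_top"
    by (rule biconjugate_gap_transfer[OF assms(1,3)])
qed

section \<open>Moments and norms\<close>

lemma ennreal_tendsto_0I:
  fixes f :: "'a \<Rightarrow> ennreal"
  assumes "\<And>e. e > 0 \<Longrightarrow> eventually (\<lambda>x. f x \<le> ennreal e) F"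
  shows "(f \<longlongrightarrow> 0) F"
proof (rule order_tendstoI)
  fix a :: ennreal assume "0 < a"
  then obtain b where b: "0 < b" "b < a" using dense by blast
  then have "b < top" using order_less_le_trans[OF b(2) top_greatest] by simp
  then obtain r where r: "r \<ge> 0" "b = ennreal r" by (cases b) auto
  with b have "r > 0" by simp
  from assms[OF this] show "eventually (\<lambda>x. f x < a) F"
    by eventually_elim (use b r in auto)
qed simp

lemma Lp_norm_le_iff:
  assumes "p > 0" "c \<ge> 0"
  shows "Lp_norm M p \<eta> \<le> ennreal c \<longleftrightarrow>
    (\<integral>\<^sup>+ x. ennreal (\<bar>\<eta> x\<bar> powr p) \<partial>M) \<le> ennreal (c powr p)"
proof (cases "\<integral>\<^sup>+ x. ennreal (\<bar>\<eta> x\<bar> powr p) \<partial>M")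
  case (real r)
  have "r powr (1 / p) \<le> c \<longleftrightarrow> r \<le> c powr p"
  proof
    assume "r powr (1 / p) \<le> c"
    then have "(r powr (1 / p)) powr p \<le> c powr p"
      using assms by (intro powr_mono2) auto
    then show "r \<le> c powr p" using real assms by (simp add: powr_powr)
  next
    assume "r \<le> c powr p"
    then have "r powr (1 / p) \<le> (c powr p) powr (1 / p)"
      using assms real by (intro powr_mono2) auto
    then show "r powr (1 / p) \<le> c" using assms by (simp add: powr_powr)
  qed
  then show ?thesis using real assms by (simp add: Lp_norm_def)
next
  case top
  then show ?thesis by (simp add: Lp_norm_def top_unique)
qed

lemma Lp_norm_ge:
  assumes "p > 0" "c \<ge> 0"
    and "ennreal (c powr p) \<le> (\<integral>\<^sup>+ x. ennreal (\<bar>\<eta> x\<bar> powr p) \<partial>M)"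
  shows "ennreal c \<le> Lp_norm M p \<eta>"
proof (cases "\<integral>\<^sup>+ x. ennreal (\<bar>\<eta> x\<bar> powr p) \<partial>M")
  case (real r)
  then have "c powr p \<le> r" using assms(3) by simp
  then have "(c powr p) powr (1 / p) \<le> r powr (1 / p)"
    using assms by (intro powr_mono2) auto
  then have "c \<le> r powr (1 / p)" using assms by (simp add: powr_powr)
  then show ?thesis using real assms by (simp add: Lp_norm_def ennreal_leI)
next
  case top
  then show ?thesis by (simp add: Lp_norm_def)
qed

lemma ennreal_divide_le_iff:
  assumes "b > 0" "c \<ge> 0"
  shows "x / ennreal b \<le> ennreal c \<longleftrightarrow> x \<le> ennreal (c * b)"
proof (cases x)
  case (real r)
  then show ?thesis using assms by (simp add: divide_ennreal pos_divide_le_eq)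
next
  case top
  then show ?thesis using assms by (simp add: ennreal_top_divide top_unique)
qed

lemma G_norm_le_iff:
  assumes "\<And>p. p \<ge> 2 \<Longrightarrow> \<psi> p > 0" "C \<ge> 0"
  shows "G_norm M \<psi> \<eta> \<le> ennreal C \<longleftrightarrow> (\<forall>p\<ge>2. Lp_norm M p \<eta> \<le> ennreal (C * \<psi> p))"
  unfolding G_norm_def using assms by (auto simp: SUP_le_iff ennreal_divide_le_iff)

lemma powr_le_truncation:
  fixes x A p :: real
  assumes "A > 0" "p > 0" "x \<ge> 0"
  shows "x powr p \<le> min x A powr p + x powr (p + 1) / A"
proof (cases "x \<le> A")
  case True
  then show ?thesis using assms by simp
next
  case False
  have "A * x powr p \<le> x * x powr p" using False by (intro mult_right_mono) auto
  also have "\<dots> = x powr (p + 1)" using assms False by (simp add: powr_add)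
  finally have "x powr p \<le> x powr (p + 1) / A" using assms by (simp add: pos_le_divide_eq mult.commute)
  then show ?thesis by (simp add: add_increasing)
qed

text \<open>This is uniform integrability: truncation at level \<open>A\<close> costs at most
  \<open>K / A\<close> by the bound on the moments of order \<open>p + 1\<close>, and the truncated
  moments vanish by dominated convergence.\<close>

lemma (in finite_measure) moment_tendsto_0:
  fixes X :: "nat \<Rightarrow> 'a \<Rightarrow> real"
  assumes [measurable]: "\<And>n. X n \<in> borel_measurable M"
    and lim: "AE x in M. (\<lambda>n. X n x) \<longlonglongrightarrow> 0" and p: "p > 0"
    and bound: "\<And>n. (\<integral>\<^sup>+ x. ennreal (\<bar>X n x\<bar> powr (p + 1)) \<partial>M) \<le> ennreal K"
  shows "(\<lambda>n. \<integral>\<^sup>+ x. ennreal (\<bar>X n x\<bar> powr p) \<partial>M) \<longlonglongrightarrow> 0"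
proof (rule ennreal_tendsto_0I)
  fix e :: real assume e: "e > 0"
  \<comment> \<open>Makes the truncation cost at most \<open>e / 2\<close>; the summand 1 keeps
    \<open>A\<close> positive when \<open>K = 0\<close>.\<close>
  define A where "A = 2 * \<bar>K\<bar> / e + 1"
  have A: "A > 0" using e unfolding A_def by (simp add: add_nonneg_pos)
  have KA: "\<bar>K\<bar> / A \<le> e / 2"
  proof -
    have "2 * \<bar>K\<bar> / e \<le> A" unfolding A_def by simp
    then show ?thesis using e A by (simp add: field_simps)
  qed
  have "(\<lambda>n. \<integral>\<^sup>+ x. ennreal (min \<bar>X n x\<bar> A powr p) \<partial>M) \<longlonglongrightarrow> (\<integral>\<^sup>+ x. 0 \<partial>M)"
  proof (rule nn_integral_dominated_convergence[where w = "\<lambda>_. ennreal (A powr p)"])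
    show "AE x in M. ennreal (min \<bar>X n x\<bar> A powr p) \<le> ennreal (A powr p)" for n
      using A p by (intro AE_I2 ennreal_leI powr_mono2) auto
    show "(\<integral>\<^sup>+ x. ennreal (A powr p) \<partial>M) < \<infinity>"
    proof -
      have "emeasure M (space M) < \<infinity>" by (metis emeasure_finite infinity_ennreal_def less_top)
      then show ?thesis by (simp add: ennreal_mult_less_top)
    qed
    show "AE x in M. (\<lambda>n. ennreal (min \<bar>X n x\<bar> A powr p)) \<longlonglongrightarrow> 0"
      using lim
    proof eventually_elim
      case (elim x)
      have "(\<lambda>n. \<bar>X n x\<bar>) \<longlonglongrightarrow> 0" using tendsto_rabs_zero[OF elim] .
      then have "(\<lambda>n. min \<bar>X n x\<bar> A) \<longlonglongrightarrow> min 0 A"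
        by (intro tendsto_min tendsto_const)
      then have "(\<lambda>n. min \<bar>X n x\<bar> A) \<longlonglongrightarrow> 0" using A by simp
      then have "(\<lambda>n. min \<bar>X n x\<bar> A powr p) \<longlonglongrightarrow> 0 powr p"
        using A p by (intro tendsto_powr' tendsto_const) (auto intro!: always_eventually)
      then show ?case using tendsto_ennrealI by fastforce
    qed
  qed auto
  then have "eventually (\<lambda>n. (\<integral>\<^sup>+ x. ennreal (min \<bar>X n x\<bar> A powr p) \<partial>M) < ennreal (e / 2)) sequentially"
    using e by (intro order_tendstoD) auto
  then show "eventually (\<lambda>n. (\<integral>\<^sup>+ x. ennreal (\<bar>X n x\<bar> powr p) \<partial>M) \<le> ennreal e) sequentially"
  proof eventually_elim
    case (elim n)
    have "(\<integral>\<^sup>+ x. ennreal (\<bar>X n x\<bar> powr p) \<partial>M) \<le>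
      (\<integral>\<^sup>+ x. ennreal (min \<bar>X n x\<bar> A powr p) + ennreal (1 / A) * ennreal (\<bar>X n x\<bar> powr (p + 1)) \<partial>M)"
    proof (rule nn_integral_mono)
      fix x
      have "ennreal (\<bar>X n x\<bar> powr p) \<le> ennreal (min \<bar>X n x\<bar> A powr p + 1 / A * \<bar>X n x\<bar> powr (p + 1))"
        using powr_le_truncation[OF A p, of "\<bar>X n x\<bar>"] by (intro ennreal_leI) simp
      also have "\<dots> = ennreal (min \<bar>X n x\<bar> A powr p) + ennreal (1 / A) * ennreal (\<bar>X n x\<bar> powr (p + 1))"
        using A by (subst ennreal_plus) (auto simp: ennreal_mult[symmetric])
      finally show "ennreal (\<bar>X n x\<bar> powr p) \<le> \<dots>" .
    qed
    also have "\<dots> = (\<integral>\<^sup>+ x. ennreal (min \<bar>X n x\<bar> A powr p) \<partial>M) +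
        ennreal (1 / A) * (\<integral>\<^sup>+ x. ennreal (\<bar>X n x\<bar> powr (p + 1)) \<partial>M)"
      by (subst nn_integral_add) (auto simp: nn_integral_cmult)
    also have "\<dots> \<le> ennreal (e / 2) + ennreal (1 / A) * ennreal \<bar>K\<bar>"
      using elim bound[of n]
      by (intro add_mono mult_left_mono) (auto intro: order_trans ennreal_leI)
    also have "\<dots> = ennreal (e / 2 + \<bar>K\<bar> / A)"
      using A e by (simp add: ennreal_mult[symmetric])
    also have "\<dots> \<le> ennreal e" using KA by (intro ennreal_leI) linarith
    finally show ?case .
  qed
qed

lemma abs_diff_powr_le:
  fixes a b p :: real
  assumes "p \<ge> 0"
  shows "\<bar>a - b\<bar> powr p \<le> 2 powr p * (\<bar>a\<bar> powr p + \<bar>b\<bar> powr p)"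
proof -
  define c where "c = max \<bar>a\<bar> \<bar>b\<bar>"
  have "\<bar>a - b\<bar> powr p \<le> (2 * c) powr p"
    using assms unfolding c_def by (intro powr_mono2) auto
  also have "\<dots> = 2 powr p * c powr p"
    unfolding c_def by (simp add: powr_mult)
  also have "\<dots> \<le> 2 powr p * (\<bar>a\<bar> powr p + \<bar>b\<bar> powr p)"
    unfolding c_def by (intro mult_left_mono) (auto simp: max_def)
  finally show ?thesis .
qed

text \<open>Fatou's lemma passes the bound on to \<open>T\<close>. In the constant 4, one factor 2
  comes from \<open>abs_diff_powr_le\<close>; the other absorbs the sum of two equal bounds, as
  \<open>2 \<le> 2 powr p\<close>.\<close>

lemma Lp_norm_diff_limit_le:
  fixes S :: "nat \<Rightarrow> 'a \<Rightarrow> real"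
  assumes [measurable]: "\<And>n. S n \<in> borel_measurable M" "T \<in> borel_measurable M"
    and lim: "AE x in M. (\<lambda>n. S n x) \<longlonglongrightarrow> T x"
    and p: "p \<ge> 1" and c: "c \<ge> 0" and bound: "\<And>n. Lp_norm M p (S n) \<le> ennreal c"
  shows "Lp_norm M p (\<lambda>x. S n x - T x) \<le> ennreal (4 * c)"
proof -
  have S: "(\<integral>\<^sup>+ x. ennreal (\<bar>S n x\<bar> powr p) \<partial>M) \<le> ennreal (c powr p)" for n
    using bound[of n] Lp_norm_le_iff[of p c M "S n"] p c by simp
  have "(\<integral>\<^sup>+ x. ennreal (\<bar>T x\<bar> powr p) \<partial>M) = (\<integral>\<^sup>+ x. liminf (\<lambda>n. ennreal (\<bar>S n x\<bar> powr p)) \<partial>M)"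
  proof (rule nn_integral_cong_AE)
    show "AE x in M. ennreal (\<bar>T x\<bar> powr p) = liminf (\<lambda>n. ennreal (\<bar>S n x\<bar> powr p))"
      using lim
    proof eventually_elim
      case (elim x)
      have "(\<lambda>n. ennreal (\<bar>S n x\<bar> powr p)) \<longlonglongrightarrow> ennreal (\<bar>T x\<bar> powr p)"
        using elim p by (intro tendsto_ennrealI tendsto_powr' tendsto_rabs tendsto_const)
          (auto intro!: always_eventually)
      then show ?case by (intro lim_imp_Liminf[symmetric]) auto
    qed
  qed
  also have "\<dots> \<le> liminf (\<lambda>n. \<integral>\<^sup>+ x. ennreal (\<bar>S n x\<bar> powr p) \<partial>M)"
    by (rule nn_integral_liminf) simp
  also have "\<dots> \<le> ennreal (c powr p)"
    by (rule Liminf_le) (auto intro!: always_eventually S)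
  finally have T: "(\<integral>\<^sup>+ x. ennreal (\<bar>T x\<bar> powr p) \<partial>M) \<le> ennreal (c powr p)" .
  have "(\<integral>\<^sup>+ x. ennreal (\<bar>S n x - T x\<bar> powr p) \<partial>M) \<le>
    (\<integral>\<^sup>+ x. ennreal (2 powr p) * (ennreal (\<bar>S n x\<bar> powr p) + ennreal (\<bar>T x\<bar> powr p)) \<partial>M)"
    using p by (intro nn_integral_mono)
      (auto simp: ennreal_mult[symmetric] ennreal_plus[symmetric] simp del: ennreal_plus
            intro!: ennreal_leI abs_diff_powr_le)
  also have "\<dots> = ennreal (2 powr p) * ((\<integral>\<^sup>+ x. ennreal (\<bar>S n x\<bar> powr p) \<partial>M) + (\<integral>\<^sup>+ x. ennreal (\<bar>T x\<bar> powr p) \<partial>M))"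
    by (simp add: nn_integral_cmult nn_integral_add)
  also have "\<dots> \<le> ennreal (2 powr p) * (ennreal (c powr p) + ennreal (c powr p))"
    by (intro mult_left_mono add_mono S T) simp
  also have "\<dots> = ennreal (2 powr p * (c powr p + c powr p))"
    by (simp add: ennreal_mult[symmetric] ennreal_plus[symmetric] del: ennreal_plus)
  also have "\<dots> \<le> ennreal ((4 * c) powr p)"
  proof (rule ennreal_leI)
    have "2 \<le> 2 powr p" using powr_mono[of 1 p 2] p by simp
    then have "2 powr p * (2 * c powr p) \<le> 2 powr p * (2 powr p * c powr p)"
      by (intro mult_left_mono mult_right_mono) auto
    also have "\<dots> = (2 * (2 * c)) powr p" using c by (metis powr_mult)
    finally show "2 powr p * (c powr p + c powr p) \<le> (4 * c) powr p" by simp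
  qed
  finally show ?thesis using p c by (subst Lp_norm_le_iff) auto
qed

section \<open>Sufficiency of the ratio condition\<close>

lemma generates_lower_bound:
  assumes "admissible V" "generates V \<nu>" "p \<ge> 2"
  shows "\<nu> p \<ge> exp (2 - \<bar>V 2\<bar>)"
proof -
  have "\<bar>V 2\<bar> * 1 \<le> \<bar>V 2\<bar> * p" using assms(3) by (intro mult_left_mono) auto
  then have "(2 - \<bar>V 2\<bar>) * p \<le> 2 * p - V 2" by (simp add: left_diff_distrib)
  also have "\<dots> \<le> conj2 V p" by (rule conj2_upper[OF assms(1)]) simp
  finally have "2 - \<bar>V 2\<bar> \<le> conj2 V p / p" using assms(3) by (simp add: pos_le_divide_eq)
  then show ?thesis using assms(2,3) unfolding generates_def by simp
qed

lemma G_norm_tendsto_0: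
  fixes S :: "nat \<Rightarrow> 'a \<Rightarrow> real"
  assumes M: "finite_measure M"
    and S[measurable]: "\<And>n. S n \<in> borel_measurable M" and T[measurable]: "T \<in> borel_measurable M"
    and lim: "AE x in M. (\<lambda>n. S n x) \<longlonglongrightarrow> T x"
    and bound: "(SUP n. G_norm M \<psi> (S n)) < \<infinity>"
    and \<psi>: "\<And>p. p \<ge> 2 \<Longrightarrow> \<psi> p > 0" and d: "d > 0" and \<nu>: "\<And>p. p \<ge> 2 \<Longrightarrow> \<nu> p \<ge> d"
    and ratio: "((\<lambda>p. \<psi> p / \<nu> p) \<longlongrightarrow> 0) at_top"
  shows "(\<lambda>n. G_norm M \<nu> (\<lambda>x. S n x - T x)) \<longlonglongrightarrow> 0"
proof (rule ennreal_tendsto_0I)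
  fix e :: real assume e: "e > 0"
  obtain C where C: "C \<ge> 0" "(SUP n. G_norm M \<psi> (S n)) = ennreal C"
    using bound by (cases "SUP n. G_norm M \<psi> (S n)") auto
  have "G_norm M \<psi> (S n) \<le> ennreal C" for n
    using SUP_upper[of n UNIV "\<lambda>n. G_norm M \<psi> (S n)"] C by simp
  then have "Lp_norm M p (S n) \<le> ennreal (C * \<psi> p)" if "p \<ge> 2" for n p
    using G_norm_le_iff[of \<psi> C M "S n"] \<psi> C(1) that by blast
  then have D: "Lp_norm M p (\<lambda>x. S n x - T x) \<le> ennreal (4 * (C * \<psi> p))" if "p \<ge> 2" for n p
    using that C(1) \<psi>[OF that] by (intro Lp_norm_diff_limit_le S T lim) auto
  have mom: "(\<lambda>n. \<integral>\<^sup>+ x. ennreal (\<bar>S n x - T x\<bar> powr p) \<partial>M) \<longlonglongrightarrow> 0" if p: "p \<ge> 2" for p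
  proof (rule finite_measure.moment_tendsto_0[OF M])
    show "(\<integral>\<^sup>+ x. ennreal (\<bar>S n x - T x\<bar> powr (p + 1)) \<partial>M)
      \<le> ennreal ((4 * (C * \<psi> (p + 1))) powr (p + 1))" for n
      using D[of "p + 1" n] p C(1) \<psi>[of "p + 1"]
        Lp_norm_le_iff[of "p + 1" "4 * (C * \<psi> (p + 1))" M "\<lambda>x. S n x - T x"] by simp
    show "AE x in M. (\<lambda>n. S n x - T x) \<longlonglongrightarrow> 0"
      using lim by eventually_elim (simp add: LIM_zero)
  qed (use p in auto)
  \<comment> \<open>The factor \<open>4 * C\<close> is the one in the bound on the norms of
    \<open>S n - T\<close>; the summand 1 avoids division by 0.\<close>
  have "eventually (\<lambda>p. \<psi> p / \<nu> p < e / (4 * C + 1)) at_top"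
    using e C(1) by (intro order_tendstoD(2)[OF ratio]) auto
  then obtain P0 where P0: "\<And>p. p \<ge> P0 \<Longrightarrow> \<psi> p / \<nu> p < e / (4 * C + 1)"
    unfolding eventually_at_top_linorder by blast
  define P where "P = max P0 2"
  \<comment> \<open>\<open>b \<le> 1\<close> gives \<open>b powr P \<le> b powr p\<close> for
    \<open>p \<le> P\<close>, and \<open>b \<le> e * d\<close> puts \<open>b\<close> below
    \<open>e * \<nu> p\<close> for every \<open>p \<ge> 2\<close>.\<close>
  define b where "b = min (e * d) 1"
  have b: "b > 0" "b \<le> 1" "b \<le> e * d" using e d unfolding b_def by auto
  have small: "eventually (\<lambda>n. (\<integral>\<^sup>+ x. ennreal (\<bar>S n x - T x\<bar> powr p) \<partial>M) < ennreal (b powr P / 2)) sequentially"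
    if "p \<ge> 2" for p
    using b by (intro order_tendstoD(2)[OF mom[OF that]]) auto
  have "P \<ge> 2" unfolding P_def by simp
  from small[OF order_refl] small[OF this]
  show "eventually (\<lambda>n. G_norm M \<nu> (\<lambda>x. S n x - T x) \<le> ennreal e) sequentially"
  proof eventually_elim
    case (elim n)
    have "Lp_norm M p (\<lambda>x. S n x - T x) \<le> ennreal (e * \<nu> p)" if p: "p \<ge> 2" for p
    proof (cases "p \<ge> P")
      case True
      have pos: "\<nu> p > 0" using \<nu>[OF p] d by simp
      have "\<psi> p / \<nu> p < e / (4 * C + 1)" using P0 True unfolding P_def by simp
      then have "(4 * C + 1) * \<psi> p < e * \<nu> p" using pos C(1) by (simp add: field_simps)
      then have "4 * (C * \<psi> p) \<le> e * \<nu> p" using \<psi>[OF p] by (simp add: algebra_simps)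
      then show ?thesis using D[OF p, of n] by (meson ennreal_leI order_trans)
    next
      case False
      \<comment> \<open>The two exponents 2 and \<open>P\<close> dominate all those between them, so
        a single \<open>n\<close> serves the whole interval.\<close>
      have powr_le: "y powr p \<le> y powr 2 + y powr P" if "y \<ge> 0" for y :: real
      proof (cases "y \<le> 1")
        case True
        then have "y powr p \<le> y powr 2" using that p by (intro powr_mono') auto
        then show ?thesis by (simp add: add_increasing2)
      next
        case 2: False
        then have "y powr p \<le> y powr P" using False by (intro powr_mono) auto
        then show ?thesis by (simp add: add_increasing)
      qed
      have "(\<integral>\<^sup>+ x. ennreal (\<bar>S n x - T x\<bar> powr p) \<partial>M) \<le>
        (\<integral>\<^sup>+ x. ennreal (\<bar>S n x - T x\<bar> powr 2) + ennreal (\<bar>S n x - T x\<bar> powr P) \<partial>M)"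
      proof (rule nn_integral_mono)
        fix x
        show "ennreal (\<bar>S n x - T x\<bar> powr p) \<le>
          ennreal (\<bar>S n x - T x\<bar> powr 2) + ennreal (\<bar>S n x - T x\<bar> powr P)"
          using ennreal_leI[OF powr_le[of "\<bar>S n x - T x\<bar>"]] by (subst ennreal_plus[symmetric]) simp_all
      qed
      also have "\<dots> = (\<integral>\<^sup>+ x. ennreal (\<bar>S n x - T x\<bar> powr 2) \<partial>M) +
          (\<integral>\<^sup>+ x. ennreal (\<bar>S n x - T x\<bar> powr P) \<partial>M)"
        by (rule nn_integral_add) auto
      also have "\<dots> \<le> ennreal (b powr P / 2) + ennreal (b powr P / 2)"
        using elim by (intro add_mono) (auto simp: P_def)
      also have "\<dots> = ennreal (b powr P)"
        by (simp add: ennreal_plus[symmetric] del: ennreal_plus)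
      also have "\<dots> \<le> ennreal (b powr p)"
        using b False by (intro ennreal_leI powr_mono') auto
      finally have "Lp_norm M p (\<lambda>x. S n x - T x) \<le> ennreal b"
        using b p by (subst Lp_norm_le_iff) auto
      also have "\<dots> \<le> ennreal (e * \<nu> p)"
      proof (rule ennreal_leI)
        have "e * d \<le> e * \<nu> p" using \<nu>[OF p] e by simp
        with b show "b \<le> e * \<nu> p" by simp
      qed
      finally show ?thesis .
    qed
    moreover have "\<nu> p > 0" if "p \<ge> 2" for p using \<nu>[OF that] d by simp
    ultimately show ?case using e by (subst G_norm_le_iff) auto
  qed
qed

lemma all_martingales_converge_if_ratio:
  assumes "\<psi> \<in> Psi" "\<nu> \<in> Psi" "((\<lambda>p. \<psi> p / \<nu> p) \<longlongrightarrow> 0) at_top"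
  shows "all_martingales_converge TYPE('a) \<psi> \<nu>"
  unfolding all_martingales_converge_def martingales_converge_def
proof (intro allI impI)
  fix M :: "'a measure" and F S T
  assume *: "prob_space M" "centered_martingale M F S" "(SUP n. G_norm M \<psi> (S n)) < \<infinity>"
    "T \<in> borel_measurable M" "AE x in M. (\<lambda>n. S n x) \<longlonglongrightarrow> T x"
  obtain W V where W: "generates W \<psi>" and V: "admissible V" "generates V \<nu>"
    using assms(1,2) unfolding Psi_def by auto
  have "S n \<in> borel_measurable M" for n
    using *(2) unfolding centered_martingale_def by (blast intro: measurable_from_subalg)
  then show "(\<lambda>n. G_norm M \<nu> (\<lambda>x. S n x - T x)) \<longlonglongrightarrow> 0"
    using * assms(3) W generates_lower_bound[OF V]
    by (intro G_norm_tendsto_0[where \<psi> = \<psi> and d = "exp (2 - \<bar>V 2\<bar>)"])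
      (auto simp: generates_def intro: prob_space.finite_measure)
qed

section \<open>Truncations of a symmetric random variable\<close>

text \<open>Large values are sent to 0 instead of being clipped, so that an increment lives where
  the earlier truncation vanishes. The strict inequality makes \<open>trunc 0\<close> constant, and
  the initial algebra trivial.\<close>

definition trunc :: "nat \<Rightarrow> real \<Rightarrow> real" where
  "trunc n x = (if \<bar>x\<bar> < real n then x else 0)"

text \<open>One generator suffices for the natural filtration, since each earlier truncation is a
  function of \<open>trunc n\<close>.\<close>

definition trunc_algebra :: "nat \<Rightarrow> real measure" where
  "trunc_algebra n = vimage_algebra UNIV (trunc n) borel"

lemma trunc_trunc: "k \<le> n \<Longrightarrow> trunc k (trunc n x) = trunc k x"
  unfolding trunc_def by auto

lemma trunc_measurable [measurable]: "trunc n \<in> borel_measurable borel"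
  unfolding trunc_def[abs_def] by measurable

lemma sets_trunc_algebra: "sets (trunc_algebra n) = {trunc n -` A | A. A \<in> sets borel}"
  unfolding trunc_algebra_def by (subst sets_vimage_algebra2) auto

lemma trunc_measurable_trunc_algebra:
  assumes "k \<le> n"
  shows "trunc k \<in> borel_measurable (trunc_algebra n)"
proof -
  have "trunc n \<in> trunc_algebra n \<rightarrow>\<^sub>M borel"
    unfolding trunc_algebra_def by (rule measurable_vimage_algebra1) simp
  from measurable_compose[OF this trunc_measurable[of k]] show ?thesis
    using assms by (simp add: trunc_trunc)
qed

lemma filtration_trunc_algebra: "filtration UNIV trunc_algebra"
proof
  show "space (trunc_algebra n) = UNIV" for n by (simp add: trunc_algebra_def)
  show "sets (trunc_algebra k) \<subseteq> sets (trunc_algebra n)" if "k \<le> n" for k n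
  proof
    fix X assume "X \<in> sets (trunc_algebra k)"
    then obtain A where "A \<in> sets borel" "X = trunc k -` A"
      unfolding sets_trunc_algebra by blast
    then show "X \<in> sets (trunc_algebra n)"
      using measurable_sets[OF trunc_measurable_trunc_algebra[OF that], of A]
      by (simp add: trunc_algebra_def)
  qed
qed

lemma sets_trunc_algebra_0: "sets (trunc_algebra 0) = {{}, UNIV}"
proof -
  have "trunc 0 -` A = (if 0 \<in> A then UNIV else {})" for A
    by (auto simp: trunc_def)
  moreover have "{0::real} \<in> sets borel" "{} \<in> sets (borel :: real measure)" by auto
  ultimately show ?thesis unfolding sets_trunc_algebra by (auto 4 4)
qed

lemma integral_symmetric_pmf_odd:
  fixes q :: "real pmf" and h :: "real \<Rightarrow> real"
  assumes "map_pmf uminus q = q" "\<And>x. h (- x) = - h x"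
  shows "(\<integral>x. h x \<partial>measure_pmf q) = 0"
proof -
  have "(\<integral>x. h x \<partial>measure_pmf q) = (\<integral>x. h x \<partial>measure_pmf (map_pmf uminus q))"
    using assms(1) by simp
  also have "\<dots> = - (\<integral>x. h x \<partial>measure_pmf q)" using assms(2) by simp
  finally show ?thesis by simp
qed

lemma integrable_trunc:
  fixes q :: "real pmf"
  shows "integrable (measure_pmf q) (trunc n)"
  by (rule measure_pmf.integrable_const_bound[where B = "real n"])
    (auto simp: trunc_def intro!: always_eventually)

text \<open>The increments are odd functions, so a symmetric law integrates them to 0, and
  restriction to an event of the earlier algebra preserves this.\<close>

lemma centered_martingale_trunc:
  fixes q :: "real pmf"
  assumes sym: "map_pmf uminus q = q"
  shows "centered_martingale (measure_pmf q) trunc_algebra trunc"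
proof -
  have odd: "trunc n (- x) = - trunc n x" for n x by (simp add: trunc_def)
  have sub: "subalgebra (measure_pmf q) (trunc_algebra n)" for n
    by (simp add: subalgebra_def trunc_algebra_def)
  have "AE x in measure_pmf q. real_cond_exp (measure_pmf q) (trunc_algebra k) (trunc n) x = trunc k x"
    if "k \<le> n" for k n
  proof -
    interpret finite_measure_subalgebra "measure_pmf q" "trunc_algebra k"
      by unfold_locales (rule sub)
    show ?thesis
    proof (rule real_cond_exp_charact)
      fix A assume "A \<in> sets (trunc_algebra k)"
      then obtain B where A: "A = trunc k -` B" unfolding sets_trunc_algebra by blast
      have int: "set_integrable (measure_pmf q) A (trunc j)" for j
        unfolding set_integrable_def by (intro integrable_mult_indicator integrable_trunc) auto
      \<comment> \<open>Where the increment does not vanish, \<open>trunc k\<close> does, so that \<open>A\<close> acts on it as a constant.\<close>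
      have "(LINT x:A|measure_pmf q. trunc n x) - (LINT x:A|measure_pmf q. trunc k x) =
        (LINT x:A|measure_pmf q. trunc n x - trunc k x)"
        by (rule set_integral_diff(2)[symmetric]) (rule int)+
      also have "\<dots> = (\<integral>x. indicator B 0 * (trunc n x - trunc k x) \<partial>measure_pmf q)"
        unfolding set_lebesgue_integral_def A
        using that by (intro Bochner_Integration.integral_cong) (auto simp: trunc_def indicator_def)
      also have "\<dots> = 0" by (rule integral_symmetric_pmf_odd[OF sym]) (simp add: odd algebra_simps)
      finally show "(LINT x:A|measure_pmf q. trunc n x) = (LINT x:A|measure_pmf q. trunc k x)" by simp
    qed (auto intro: integrable_trunc trunc_measurable_trunc_algebra)
  qed
  then show ?thesis
    unfolding centered_martingale_def
    using filtration_trunc_algebra sets_trunc_algebra_0 sub integrable_trunc[of q]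
      integral_symmetric_pmf_odd[OF sym, of "trunc _", OF odd] trunc_measurable_trunc_algebra
    by simp
qed

lemma trunc_tendsto: "(\<lambda>n. trunc n x) \<longlonglongrightarrow> x"
proof (rule tendsto_eventually)
  obtain N where "\<bar>x\<bar> < real N" using reals_Archimedean2 by blast
  then have "trunc n x = x" if "n \<ge> N" for n using that unfolding trunc_def by auto
  then show "eventually (\<lambda>n. trunc n x = x) sequentially"
    unfolding eventually_sequentially by blast
qed

section \<open>Symmetric discrete laws\<close>

definition symmetric_pmf :: "(nat \<Rightarrow> real) \<Rightarrow> nat pmf \<Rightarrow> real pmf" where
  "symmetric_pmf a Q =
    map_pmf (\<lambda>(k, b). if b then a k else - a k) (pair_pmf Q (bernoulli_pmf (1 / 2)))"

text \<open>Reflection amounts to flipping the independent fair coin that chooses the sign, and the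
  flip preserves the law of the coin.\<close>

lemma map_uminus_symmetric_pmf: "map_pmf uminus (symmetric_pmf a Q) = symmetric_pmf a Q"
proof -
  have *: "map_pmf Not (bernoulli_pmf (1 / 2)) = bernoulli_pmf (1 / 2)"
    by (subst bernoulli_pmf_half_conv_pmf_of_set)+
      (intro map_pmf_of_set_bij_betw bij_betwI[where g = Not], auto)
  have "symmetric_pmf a Q =
    map_pmf (\<lambda>(k, b). if b then a k else - a k) (pair_pmf Q (map_pmf Not (bernoulli_pmf (1 / 2))))"
    unfolding symmetric_pmf_def * ..
  also have "\<dots> = map_pmf uminus (symmetric_pmf a Q)"
    unfolding symmetric_pmf_def pair_map_pmf2 pmf.map_comp
    by (intro pmf.map_cong refl) auto
  finally show ?thesis ..
qed

text \<open>An even function does not see the sign, so the coin integrates out.\<close>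

lemma nn_integral_symmetric_pmf_even:
  fixes h :: "real \<Rightarrow> ennreal"
  assumes "\<And>x. h (- x) = h x"
  shows "(\<integral>\<^sup>+ x. h x \<partial>measure_pmf (symmetric_pmf a Q)) = (\<Sum>k. ennreal (pmf Q k) * h (a k))"
proof -
  have "(\<integral>\<^sup>+ x. h x \<partial>measure_pmf (symmetric_pmf a Q)) =
    (\<integral>\<^sup>+ k. \<integral>\<^sup>+ b. h (a k) \<partial>measure_pmf (bernoulli_pmf (1 / 2)) \<partial>measure_pmf Q)"
    unfolding symmetric_pmf_def using assms
    by (simp add: nn_integral_pair_pmf' if_distrib cong: if_cong)
  also have "\<dots> = (\<integral>\<^sup>+ k. h (a k) \<partial>measure_pmf Q)" by simp
  also have "\<dots> = (\<Sum>k. ennreal (pmf Q k) * h (a k))"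
    by (simp add: nn_integral_measure_pmf nn_integral_count_space_nat)
  finally show ?thesis .
qed

section \<open>The extremal distribution\<close>

text \<open>
  Slow variation of \<open>L\<close> makes \<open>W (v + 1) / W v\<close> tend to \<open>exp m\<close>, whence \<open>W\<close> grows exponentially.
\<close>

lemma EL_growth:
  assumes m: "m > 0" and L: "L \<in> SV m" and W: "\<And>u. u \<ge> exp 2 \<Longrightarrow> W (ln u) = u powr m * L u"
  shows "\<exists>C. \<forall>k. (real k + 2)\<^sup>2 \<le> W (real k + 2) + C"
proof -
  \<comment> \<open>The ratio \<open>W (v + 1) / W v\<close> tends to \<open>exp m\<close>; giving
    up half of the exponent leaves a rate above 1 that holds for all large \<open>v\<close>.\<close>
  define r where "r = exp (m / 2)"
  have r: "r > 1" using m unfolding r_def by simp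
  have Lpos: "L u > 0" if "u \<ge> 0" for u using L that unfolding SV_def by blast
  have Wexp: "W v = exp (m * v) * L (exp v)" if "v \<ge> 2" for v
    using W[of "exp v"] that by (simp add: powr_def)
  have "((\<lambda>u. L (exp 1 * u) / L u) \<longlongrightarrow> 1) at_top"
    using L unfolding SV_def slowly_varying_def by simp
  then have "eventually (\<lambda>u. L (exp 1 * u) / L u > exp (- (m / 2))) at_top"
    by (rule order_tendstoD) (use m in simp)
  then have "eventually (\<lambda>v. L (exp 1 * exp v) / L (exp v) > exp (- (m / 2))) at_top"
    using exp_at_top filterlim_iff by fast
  then obtain v0 where v0: "\<And>v. v \<ge> v0 \<Longrightarrow> L (exp 1 * exp v) / L (exp v) > exp (- (m / 2))"
    unfolding eventually_at_top_linorder by blast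
  have step: "W (v + 1) \<ge> r * W v" if "v \<ge> v0" "v \<ge> 2" for v
  proof -
    have "exp (- (m / 2)) * L (exp v) \<le> L (exp 1 * exp v)"
      using v0[OF that(1)] Lpos[of "exp v"] by (simp add: pos_less_divide_eq less_imp_le)
    then have "exp (m * (v + 1)) * (exp (- (m / 2)) * L (exp v)) \<le> exp (m * (v + 1)) * L (exp 1 * exp v)"
      by (intro mult_left_mono) auto
    moreover have "exp (m * (v + 1)) * exp (- (m / 2)) = r * exp (m * v)"
      unfolding r_def by (simp add: exp_add[symmetric] algebra_simps)
    ultimately have "r * exp (m * v) * L (exp v) \<le> exp (m * (v + 1)) * L (exp (1 + v))"
      by (simp add: exp_add mult.assoc[symmetric])
    then show ?thesis
      using that Wexp[of v] Wexp[of "v + 1"] by (simp add: mult.assoc add.commute)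
  qed
  obtain N where N: "real N \<ge> v0" using real_arch_simple by blast
  define w where "w = W (real N + 2)"
  have w: "w > 0" unfolding w_def using Wexp[of "real N + 2"] Lpos by simp
  have grow: "W (real N + 2 + real j) \<ge> r ^ j * w" for j
  proof (induction j)
    case 0
    then show ?case by (simp add: w_def)
  next
    case (Suc j)
    have "r ^ Suc j * w \<le> r * W (real N + 2 + real j)" using Suc r by simp
    also have "\<dots> \<le> W (real N + 2 + real j + 1)" by (rule step) (use N in auto)
    finally show ?case by (simp add: add_ac)
  qed
  have "filterlim (\<lambda>j. r ^ j * w - (real N + 2 + real j)\<^sup>2) at_top sequentially"
    using r w by real_asymp
  then have "eventually (\<lambda>j. r ^ j * w - (real N + 2 + real j)\<^sup>2 \<ge> 0) sequentially"
    unfolding filterlim_at_top by blast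
  then obtain J where J: "\<And>j. j \<ge> J \<Longrightarrow> (real N + 2 + real j)\<^sup>2 \<le> r ^ j * w"
    unfolding eventually_sequentially by fastforce
  have Wpos: "W (real k + 2) > 0" for k using Wexp[of "real k + 2"] Lpos by simp
  show ?thesis
  \<comment> \<open>The constant covers the finitely many \<open>k < N + J\<close>, where only
    positivity of \<open>W\<close> is available.\<close>
  proof (intro exI allI)
    fix k
    show "(real k + 2)\<^sup>2 \<le> W (real k + 2) + (real (N + J) + 2)\<^sup>2"
    proof (cases "k \<ge> N + J")
      case True
      define j where "j = k - N"
      have "J \<le> j" using True unfolding j_def by simp
      then have "(real N + 2 + real j)\<^sup>2 \<le> W (real N + 2 + real j)"
        using J[of j] grow[of j] by simp
      moreover have "real N + 2 + real j = real k + 2" using True unfolding j_def by simp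
      ultimately have "(real k + 2)\<^sup>2 \<le> W (real k + 2)" by simp
      then show ?thesis by (simp add: add_increasing2)
    next
      case False
      then have "(real k + 2)\<^sup>2 \<le> (real (N + J) + 2)\<^sup>2" by (intro power_mono) auto
      then show ?thesis using Wpos[of k] by linarith
    qed
  qed
qed

text \<open>For \<open>k + 2 \<le> p + 1\<close> the term \<open>p + 1 - k\<close> is nonnegative.
  Beyond that the quadratic growth of \<open>W\<close> beats \<open>p * (k + 2)\<close> by at least
  \<open>k\<close>, up to \<open>C\<close>. The decay in \<open>k\<close> makes the moment series
  geometric, and the loss \<open>p\<close> costs only a factor \<open>exp 1\<close> in the
  p-norm.\<close>

lemma conjugate_term_bound:
  assumes W: "admissible W" and C: "(real k + 2)\<^sup>2 \<le> W (real k + 2) + C" and p: "p \<ge> 2"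
  shows "p * (real k + 2) - W (real k + 2) \<le> conj2 W p + p + 1 + \<bar>C\<bar> + \<bar>W 2\<bar> - real k"
proof (cases "real k + 2 \<le> p + 1")
  case True
  have "(real k + 2) * p - W (real k + 2) \<le> conj2 W p" by (rule conj2_upper[OF W]) simp
  then show ?thesis using True by (simp add: mult.commute)
next
  case False
  have "(real k + 2) * (p + 1) \<le> (real k + 2) * (real k + 2)" using False by (intro mult_left_mono) auto
  then have "p * (real k + 2) - W (real k + 2) \<le> C - real k"
    using C by (simp add: algebra_simps power2_eq_square)
  moreover have "2 * p - W 2 \<le> conj2 W p" by (rule conj2_upper[OF W]) simp
  ultimately show ?thesis using p by linarith
qed

text \<open>
  The masses \<open>pmf Q k\<close> are proportional to \<open>exp (- W (k + 2))\<close>, so the summands of the \<open>p\<close>-th moment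
  are proportional to \<open>exp (p * v - W v)\<close> at integer points \<open>v\<close>, and the largest one is comparable to
  \<open>exp (conj2 W p)\<close>.
\<close>

lemma extremal_pmf:
  assumes C: "\<And>k. (real k + 2)\<^sup>2 \<le> W (real k + 2) + C"
  obtains Q :: "nat pmf" and Z where "Z > 0" "\<And>k. pmf Q k = exp (- W (real k + 2)) / Z"
proof -
  have le: "exp (- W (real k + 2)) \<le> exp C * exp (- 1) ^ k" for k
  proof -
    have "real k \<le> (real k + 2)\<^sup>2" by (simp add: power2_eq_square algebra_simps add_increasing2)
    then have "- W (real k + 2) \<le> C + real k * (- 1)" using C[of k] by simp
    then show ?thesis by (simp add: exp_of_nat_mult[symmetric] exp_add[symmetric])
  qed
  have "summable (\<lambda>k. exp C * exp (- 1) ^ k :: real)"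
    by (intro summable_mult summable_geometric) simp
  then have sm: "summable (\<lambda>k. exp (- W (real k + 2)))"
    by (rule summable_comparison_test'[where N = 0]) (use le in auto)
  define Z where "Z = (\<Sum>k. exp (- W (real k + 2)))"
  have Z: "Z > 0" unfolding Z_def by (rule suminf_pos[OF sm]) simp
  define f where "f k = exp (- W (real k + 2)) / Z" for k
  have "f sums (Z / Z)" unfolding f_def Z_def
    by (intro sums_divide summable_sums sm)
  then have "(\<Sum>k. ennreal (f k)) = ennreal 1"
    using Z by (intro suminf_ennreal_eq) (simp_all add: f_def[abs_def])
  then have "(\<integral>\<^sup>+ k. ennreal (f k) \<partial>count_space UNIV) = 1"
    by (simp add: nn_integral_count_space_nat)
  then have "pmf (embed_pmf f) k = f k" for k
    using Z by (intro pmf_embed_pmf) (auto simp: f_def)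
  then show ?thesis using that[OF Z, of "embed_pmf f"] unfolding f_def by blast
qed

lemma extremal_moment_upper:
  assumes W: "admissible W" and C: "\<And>k. (real k + 2)\<^sup>2 \<le> W (real k + 2) + C"
    and Z: "Z > 0" and Q: "\<And>k. pmf Q k = exp (- W (real k + 2)) / Z"
  obtains B where "B \<ge> 0" "\<And>p. p \<ge> 2 \<Longrightarrow>
    (\<integral>\<^sup>+ x. ennreal (\<bar>x\<bar> powr p) \<partial>measure_pmf (symmetric_pmf (\<lambda>k. exp (real k + 2)) Q))
      \<le> ennreal ((B * exp (conj2 W p / p)) powr p)"
proof
  define G where "G = (\<Sum>k. exp (- 1) ^ k :: real)"
  have sm: "summable (\<lambda>k. exp (- 1) ^ k :: real)" by (intro summable_geometric) simp
  have G: "G > 0" unfolding G_def by (rule suminf_pos[OF sm]) simp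
  \<comment> \<open>Collects the constants free of \<open>p\<close>, including the normalisation. As
    \<open>D \<ge> 0\<close>, \<open>exp D\<close> is at most its p-th power; the 1 in
    \<open>exp (1 + D)\<close> accounts for the summand \<open>p\<close> in the exponent of
    \<open>E\<close>.\<close>
  define D where "D = \<bar>1 + \<bar>C\<bar> + \<bar>W 2\<bar> + ln (G / Z)\<bar>"
  show "0 \<le> exp (1 + D)" by simp
  fix p :: real assume p: "p \<ge> 2"
  define E where "E = exp (conj2 W p + p + 1 + \<bar>C\<bar> + \<bar>W 2\<bar>) / Z"
  have summand: "exp (- W (real k + 2)) / Z * exp (real k + 2) powr p \<le> E * exp (- 1) ^ k" for k
  proof -
    have "exp (- W (real k + 2)) * exp (real k + 2) powr p = exp (p * (real k + 2) - W (real k + 2))"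
      by (simp add: powr_def exp_add[symmetric] algebra_simps)
    also have "\<dots> \<le> exp (conj2 W p + p + 1 + \<bar>C\<bar> + \<bar>W 2\<bar> + real k * (- 1))"
      using conjugate_term_bound[OF W C p, of k] by simp
    also have "\<dots> = exp (conj2 W p + p + 1 + \<bar>C\<bar> + \<bar>W 2\<bar>) * exp (- 1) ^ k"
      unfolding exp_of_nat_mult[symmetric] exp_add[symmetric] ..
    finally show ?thesis using Z unfolding E_def by (simp add: divide_right_mono)
  qed
  have "(\<integral>\<^sup>+ x. ennreal (\<bar>x\<bar> powr p) \<partial>measure_pmf (symmetric_pmf (\<lambda>k. exp (real k + 2)) Q)) =
    (\<Sum>k. ennreal (exp (- W (real k + 2)) / Z * exp (real k + 2) powr p))"
    using Z by (subst nn_integral_symmetric_pmf_even) (auto simp: Q ennreal_mult[symmetric])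
  also have "\<dots> \<le> (\<Sum>k. ennreal (E * exp (- 1) ^ k))"
    by (intro suminf_le ennreal_leI summand) auto
  also have "\<dots> = ennreal (E * G)"
    unfolding G_def using Z sm
    by (intro suminf_ennreal_eq sums_mult summable_sums) (auto simp: E_def)
  also have "\<dots> \<le> ennreal ((exp (1 + D) * exp (conj2 W p / p)) powr p)"
  proof (rule ennreal_leI)
    have "E * G = exp (conj2 W p + p + 1 + \<bar>C\<bar> + \<bar>W 2\<bar> + ln (G / Z))"
      unfolding E_def using G Z by (simp add: exp_add)
    also have "\<dots> \<le> exp (p * (1 + D) + conj2 W p)"
    proof -
      have "D * 1 \<le> D * p" using p unfolding D_def by (intro mult_left_mono) auto
      moreover have "1 + \<bar>C\<bar> + \<bar>W 2\<bar> + ln (G / Z) \<le> D" unfolding D_def by simp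
      ultimately show ?thesis by (simp add: algebra_simps)
    qed
    also have "\<dots> = (exp (1 + D) * exp (conj2 W p / p)) powr p"
      using p by (simp add: powr_def exp_add[symmetric] algebra_simps)
    finally show "E * G \<le> (exp (1 + D) * exp (conj2 W p / p)) powr p" .
  qed
  finally show "(\<integral>\<^sup>+ x. ennreal (\<bar>x\<bar> powr p) \<partial>measure_pmf (symmetric_pmf (\<lambda>k. exp (real k + 2)) Q))
      \<le> ennreal ((exp (1 + D) * exp (conj2 W p / p)) powr p)" .
qed

text \<open>A single atom suffices: the integer point just below a near-maximiser carries enough of
  the moment, and for large \<open>p\<close> it lies where \<open>trunc n\<close> vanishes.\<close>

lemma extremal_tail_lower:
  assumes W: "admissible W"
    and Z: "Z > 0" and Q: "\<And>k. pmf Q k = exp (- W (real k + 2)) / Z"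
  obtains c where "c > 0" "\<And>n. eventually (\<lambda>p. ennreal (c * exp (conj2 W p / p)) \<le>
    Lp_norm (measure_pmf (symmetric_pmf (\<lambda>k. exp (real k + 2)) Q)) p (\<lambda>x. trunc n x - x)) at_top"
proof
  \<comment> \<open>In the exponent, rounding to an integer costs \<open>p\<close>, the
    near-maximiser costs 1 and the normalisation costs \<open>ln Z\<close>. Each is at most a
    constant times \<open>p\<close>, which gives a constant factor after the p-th root.\<close>
  define c where "c = exp (- (2 + \<bar>ln Z\<bar>))"
  show "c > 0" unfolding c_def by simp
  fix n
  show "eventually (\<lambda>p. ennreal (c * exp (conj2 W p / p)) \<le>
    Lp_norm (measure_pmf (symmetric_pmf (\<lambda>k. exp (real k + 2)) Q)) p (\<lambda>x. trunc n x - x)) at_top"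
    using eventually_conj2_approx[OF W, of "real n + 3"] eventually_ge_at_top[of 2]
  proof eventually_elim
    case (elim p)
    then obtain v where v: "v \<ge> real n + 3" "conj2 W p - 1 \<le> v * p - W v" by blast
    \<comment> \<open>Rounding down does not increase \<open>W\<close>. The margin in
      \<open>v \<ge> real n + 3\<close> makes \<open>v - 2\<close> nonnegative and keeps the atom
      beyond level \<open>n\<close>.\<close>
    define k where "k = nat \<lfloor>v - 2\<rfloor>"
    have k: "real k + 2 \<le> v" "v < real k + 3" using v(1) unfolding k_def by linarith+
    have big: "real n \<le> exp (real k + 2)"
      using exp_ge_add_one_self[of "real k + 2"] k v(1) by linarith
    have Wk: "W (real k + 2) \<le> W v"
      using W k(1) unfolding admissible_def
      by (cases "real k + 2 = v") (auto simp: strict_mono_on_def intro: less_imp_le)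
    have "(c * exp (conj2 W p / p)) powr p = exp (conj2 W p - (2 + \<bar>ln Z\<bar>) * p)"
      unfolding c_def using elim(2) by (simp add: powr_def exp_add[symmetric] algebra_simps)
    also have "\<dots> \<le> exp (p * (real k + 2) - W (real k + 2) - ln Z)"
    proof -
      have "v * p \<le> (real k + 3) * p" using k elim(2) by (intro mult_right_mono) auto
      moreover have "\<bar>ln Z\<bar> * 1 \<le> \<bar>ln Z\<bar> * p" using elim(2) by (intro mult_left_mono) auto
      ultimately show ?thesis using v(2) Wk elim(2) by (simp add: algebra_simps)
    qed
    also have "\<dots> = exp (- W (real k + 2)) / Z * exp (real k + 2) powr p"
      using Z by (simp add: powr_def exp_diff exp_minus divide_simps)
    finally have le: "(c * exp (conj2 W p / p)) powr p \<le> pmf Q k * exp (real k + 2) powr p"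
      unfolding Q .
    let ?h = "\<lambda>x. ennreal (\<bar>trunc n x - x\<bar> powr p)"
    have "ennreal ((c * exp (conj2 W p / p)) powr p) \<le> ennreal (pmf Q k) * ?h (exp (real k + 2))"
      using le big by (simp add: trunc_def ennreal_mult[symmetric] ennreal_leI)
    also have "\<dots> \<le> (\<Sum>k. ennreal (pmf Q k) * ?h (exp (real k + 2)))"
      using sum_le_suminf[of "\<lambda>k. ennreal (pmf Q k) * ?h (exp (real k + 2))" "{k}"] by simp
    also have "\<dots> = (\<integral>\<^sup>+ x. ?h x \<partial>measure_pmf (symmetric_pmf (\<lambda>k. exp (real k + 2)) Q))"
      by (rule nn_integral_symmetric_pmf_even[symmetric]) (auto simp: trunc_def)
    finally show ?case
      using elim(2) \<open>c > 0\<close> by (intro Lp_norm_ge) auto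
  qed
qed

section \<open>Necessity of the ratio condition, and the equivalences\<close>

lemma ratio_tendsto_0_if_all_martingales_converge:
  assumes m: "m > 0" and \<psi>: "\<psi> \<in> EL m" and \<nu>: "\<nu> \<in> Psi"
    and conv: "all_martingales_converge TYPE(real) \<psi> \<nu>"
  shows "((\<lambda>p. \<psi> p / \<nu> p) \<longlongrightarrow> 0) at_top"
proof -
  obtain W L where W: "admissible W" "generates W \<psi>" and L: "L \<in> SV m"
    and WL: "\<And>u. u \<ge> exp 2 \<Longrightarrow> W (ln u) = u powr m * L u"
    using \<psi> unfolding EL_def by blast
  have \<psi>_eq: "\<psi> p = exp (conj2 W p / p)" if "p \<ge> 2" for p
    using W(2) that unfolding generates_def by blast
  have \<nu>_pos: "\<nu> p > 0" if "p \<ge> 2" for p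
    using \<nu> that unfolding Psi_def generates_def by auto
  obtain C where C: "\<And>k. (real k + 2)\<^sup>2 \<le> W (real k + 2) + C"
    using EL_growth[OF m L WL] by blast
  obtain Q :: "nat pmf" and Z where Q: "Z > 0" "\<And>k. pmf Q k = exp (- W (real k + 2)) / Z"
    using extremal_pmf[OF C] by blast
  define M where "M = measure_pmf (symmetric_pmf (\<lambda>k. exp (real k + 2)) Q)"
  obtain B where B: "B \<ge> 0" "\<And>p. p \<ge> 2 \<Longrightarrow>
      (\<integral>\<^sup>+ x. ennreal (\<bar>x\<bar> powr p) \<partial>M) \<le> ennreal ((B * exp (conj2 W p / p)) powr p)"
    using extremal_moment_upper[OF W(1) C Q] unfolding M_def by blast
  obtain c where c: "c > 0" "\<And>n. eventually (\<lambda>p. ennreal (c * exp (conj2 W p / p)) \<le>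
      Lp_norm M p (\<lambda>x. trunc n x - x)) at_top"
    using extremal_tail_lower[OF W(1) Q] unfolding M_def by blast
  have "G_norm M \<psi> (trunc n) \<le> ennreal B" for n
  proof -
    have "Lp_norm M p (trunc n) \<le> ennreal (B * \<psi> p)" if p: "p \<ge> 2" for p
    proof -
      have "(\<integral>\<^sup>+ x. ennreal (\<bar>trunc n x\<bar> powr p) \<partial>M) \<le> (\<integral>\<^sup>+ x. ennreal (\<bar>x\<bar> powr p) \<partial>M)"
        by (intro nn_integral_mono) (auto simp: trunc_def)
      also note B(2)[OF p]
      finally show ?thesis
        using p B(1) by (subst Lp_norm_le_iff) (auto simp: \<psi>_eq)
    qed
    then show ?thesis using B(1) by (subst G_norm_le_iff) (auto simp: \<psi>_eq)
  qed
  then have "(SUP n. G_norm M \<psi> (trunc n)) < \<infinity>"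
    by (intro le_less_trans[OF SUP_least]) auto
  moreover have "prob_space M" unfolding M_def by (rule measure_pmf.prob_space_axioms)
  moreover have "centered_martingale M trunc_algebra trunc"
    unfolding M_def by (rule centered_martingale_trunc[OF map_uminus_symmetric_pmf])
  moreover have "(\<lambda>x. x) \<in> borel_measurable M" unfolding M_def by simp
  ultimately have lim: "(\<lambda>n. G_norm M \<nu> (\<lambda>x. trunc n x - x)) \<longlonglongrightarrow> 0"
    using conv unfolding all_martingales_converge_def martingales_converge_def
    by (auto simp: trunc_tendsto)
  show ?thesis
  proof (rule tendstoI)
    fix e :: real assume e: "e > 0"
    \<comment> \<open>Since \<open>c\<close> does not depend on \<open>n\<close>, one index with
      norm at most \<open>c * e / 2\<close> controls the ratio for all large \<open>p\<close>:
      \<open>c\<close> cancels, and the factor 1/2 gives strictness.\<close>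
    have "eventually (\<lambda>n. G_norm M \<nu> (\<lambda>x. trunc n x - x) < ennreal (c * e / 2)) sequentially"
      using e c(1) by (intro order_tendstoD(2)[OF lim]) auto
    then obtain n where n: "G_norm M \<nu> (\<lambda>x. trunc n x - x) \<le> ennreal (c * e / 2)"
      unfolding eventually_sequentially by (meson less_imp_le order_refl)
    show "eventually (\<lambda>p. dist (\<psi> p / \<nu> p) 0 < e) at_top"
      using c(2)[of n] eventually_ge_at_top[of 2]
    proof eventually_elim
      case (elim p)
      have "\<forall>p\<ge>2. Lp_norm M p (\<lambda>x. trunc n x - x) \<le> ennreal (c * e / 2 * \<nu> p)"
        using n e c(1) by (subst (asm) G_norm_le_iff) (auto simp: \<nu>_pos)
      then have "ennreal (c * \<psi> p) \<le> ennreal (c * e / 2 * \<nu> p)"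
        using elim \<psi>_eq[of p] by (auto intro: order_trans)
      then have "c * \<psi> p \<le> c * e / 2 * \<nu> p"
        using c(1) e \<nu>_pos[OF elim(2)] by (subst (asm) ennreal_le_iff) auto
      then have "\<psi> p \<le> e / 2 * \<nu> p" using c(1) by simp
      also have "\<dots> < e * \<nu> p" using e \<nu>_pos[OF elim(2)] by simp
      finally have "\<psi> p / \<nu> p < e" using \<nu>_pos[OF elim(2)] by (simp add: pos_divide_less_eq)
      moreover have "\<psi> p > 0" using \<psi>_eq[OF elim(2)] by simp
      ultimately show ?case using \<nu>_pos[OF elim(2)] by simp
    qed
  qed
qed

theorem theorem10:
  fixes m :: real and \<psi> \<nu> :: "real \<Rightarrow> real"
  assumes "m > 0" and "\<psi> \<in> Psi" and "\<psi> \<in> EL m" and "\<nu> \<in> Psi"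
  shows "(all_martingales_converge TYPE(real) \<psi> \<nu> \<longleftrightarrow> ((\<lambda>p. \<psi> p / \<nu> p) \<longlongrightarrow> 0) at_top) \<and>
         (((\<lambda>p. \<psi> p / \<nu> p) \<longlongrightarrow> 0) at_top \<longrightarrow> all_martingales_converge TYPE('a) \<psi> \<nu>) \<and>
         (((\<lambda>p. \<psi> p / \<nu> p) \<longlongrightarrow> 0) at_top \<longleftrightarrow> N_fun \<nu> \<lless> N_fun \<psi>)"
proof -
  obtain W V where "admissible W" "generates W \<psi>" "admissible V" "generates V \<nu>"
    using assms(2,4) unfolding Psi_def by blast
  then show ?thesis
    using ratio_tendsto_0_iff_weaker[of W \<psi> V \<nu>]
      ratio_tendsto_0_if_all_martingales_converge[OF assms(1,3,4)]
      all_martingales_converge_if_ratio[where 'a = real, OF assms(2,4)]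
      all_martingales_converge_if_ratio[where 'a = 'a, OF assms(2,4)]
    by blast
qed

end
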